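(* Let $\lambda>0$, $a<b$, $I=[a,b]$ and $f\in C^0[a,b]$, and let $\tau_j$ and $m_j$ be the associated times and values defined in the context. Suppose that $P=[a=t_0<t_1<\cdots<t_k<t_{k+1}=b]$ is a partition of $I$ such that $\Phi_{I,\lambda,P}(f)=\Phi_{I,\lambda}(f)$, and moreover that $|P|$ is maximal over all partitions of $I$ with this property. For each $j\ge1$ such that $\tau_{j-1}<b$, the following trichotomy holds. (1) If $\tau_j<b$, then $k\ge j$ and $t_j\in[\tau_{j-1},\tau_j]$, and $[t_{j-1},t_j]$ is an uptick if $\tau_{j-1}$ is an upstop and a downtick if $\tau_{j-1}$ is a downstop. (2) If $\tau_j\ge b$ and $|m_j-f(b)|\ge\lambda/2$, then $k=j$ and $t_j\in[\tau_{j-1},b)$. (3) If $\tau_j\ge b$ and $|m_j-f(b)|<\lambda/2$, then $k=j-1$. Moreover, whenever $1\le j\le k$, we have $f(t_j)=m_j$.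
   Context: Partitions. A partition of $I=[a,b]$ is $P=[a=t_0<t_1<\cdots<t_k<t_{k+1}=b]$ with $k\ge0$; $|P|=k$. Set $\Phi_{I,\lambda,P}(f)=\sum_{i=1}^{k+1}|f(t_i)-f(t_{i-1})|-\lambda|P|$ and $\Phi_{I,\lambda}(f)=\sup_P\Phi_{I,\lambda,P}(f)$, the supremum being over all partitions $P$ of $I$. Upticks and downticks. An interval $[x,y]$ is an uptick (resp. downtick) for $f$ if $f(y)>f(x)$ (resp. $f(y)<f(x)$). Times $\tau_j$. Extend $f$ to a continuous function on $[a,\infty)$ arbitrarily. With the convention $\min\emptyset=\infty$, let $\tau_0^{\mathrm{up}}=\min\{t>a: f(t)\ge f(a)+\lambda/2\}$, $\tau_0^{\mathrm{down}}=\min\{t>a: f(t)\le f(a)-\lambda/2\}$ and $\tau_0=\min(\tau_0^{\mathrm{up}},\tau_0^{\mathrm{down}})$. Write $s\wedge t=\min(s,t)$. Call $\tau_0$ an upstop if $f(\tau_0\wedge b)>f(a)$ and a downstop if $f(\tau_0\wedge b)<f(a)$. Inductively for $j\ge1$: if $\tau_{j-1}$ is an upstop, let $\tau_j=\min\{t>\tau_{j-1}: \max_{\tau_{j-1}\le s\le t}f(s)-f(t)\ge\lambda\}$ and call $\tau_j$ a downstop; if $\tau_{j-1}$ is a downstop, let $\tau_j=\min\{t>\tau_{j-1}: f(t)-\min_{\tau_{j-1}\le s\le t}f(s)\ge\lambda\}$ and call $\tau_j$ an upstop. (If $\tau_0$ is neither an upstop nor a downstop, which forces $\tau_0\ge b$,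 set $\tau_j=\infty$ for all $j\ge1$.) Values $m_j$. $m_0=f(a)$, and for $j\ge1$ with $\tau_{j-1}<b$, $m_j=\max_{\tau_{j-1}\le s\le\tau_j\wedge b}f(s)$ if $\tau_j$ is a downstop, and $m_j=\min_{\tau_{j-1}\le s\le\tau_j\wedge b}f(s)$ if $\tau_j$ is an upstop. *)

theory Defs
  imports "HOL-Analysis.Analysis"
begin

text \<open>A partition \<open>a = t\<^sub>0 < \<dots> < t\<^bsub>k+1\<^esub> = b\<close> is the list of its points, so that \<open>t\<^sub>i\<close> is
  \<open>P ! i\<close>; its size \<open>|P| = k\<close> counts the interior points only.\<close>

definition partition_of :: "real \<Rightarrow> real \<Rightarrow> real list \<Rightarrow> bool" where
  "partition_of a b P \<longleftrightarrow> length P \<ge> 2 \<and> sorted_wrt (<) P \<and> hd P = a \<and> last P = b"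

definition psize :: "real list \<Rightarrow> nat" where
  "psize P = length P - 2"

definition Phi_part :: "real \<Rightarrow> real list \<Rightarrow> (real \<Rightarrow> real) \<Rightarrow> real" where
  "Phi_part l P f = (\<Sum>i=1..psize P + 1. \<bar>f (P ! i) - f (P ! (i - 1))\<bar>) - l * real (psize P)"

text \<open>The supremum is taken in the extended reals, so that no boundedness is presupposed.\<close>

definition Phi :: "real \<Rightarrow> real \<Rightarrow> real \<Rightarrow> (real \<Rightarrow> real) \<Rightarrow> ereal" where
  "Phi a b l f = (SUP P \<in> {P. partition_of a b P}. ereal (Phi_part l P f))"

definition uptick :: "(real \<Rightarrow> real) \<Rightarrow> real \<Rightarrow> real \<Rightarrow> bool" where
  "uptick f x y \<longleftrightarrow> f y > f x"

definition downtick :: "(real \<Rightarrow> real) \<Rightarrow> real \<Rightarrow> real \<Rightarrow> bool" where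
  "downtick f x y \<longleftrightarrow> f y < f x"

text \<open>Minimum of a set of times with the convention \<open>min \<emptyset> = \<infinity>\<close>. It is only applied to sets that
  are empty or, by continuity, have a least element.\<close>

definition min_time :: "real set \<Rightarrow> ereal" where
  "min_time S = (if S = {} then \<infinity> else ereal (LEAST t. t \<in> S))"

datatype stop_kind = Upstop | Downstop | Nostop

text \<open>In what follows \<open>g\<close> is a continuous function on \<open>[a, \<infinity>)\<close> extending \<open>f\<close>. Maxima and minima of
  \<open>g\<close> over compact intervals are written as \<open>SUP\<close> and \<open>INF\<close>.\<close>

definition tau0 :: "(real \<Rightarrow> real) \<Rightarrow> real \<Rightarrow> real \<Rightarrow> ereal" where
  "tau0 g l a = min (min_time {t. t > a \<and> g t \<ge> g a + l / 2})
                    (min_time {t. t > a \<and> g t \<le> g a - l / 2})"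

definition kind0 :: "(real \<Rightarrow> real) \<Rightarrow> real \<Rightarrow> real \<Rightarrow> real \<Rightarrow> stop_kind" where
  "kind0 g l a b =
     (let y = g (real_of_ereal (min (tau0 g l a) (ereal b)))
      in if y > g a then Upstop else if y < g a then Downstop else Nostop)"

text \<open>The pair of \<open>\<tau>\<^sub>j\<close> and its kind. If \<open>\<tau>\<^sub>j = \<infinity>\<close>, the set defining the next time is empty, and
  all later times are \<open>\<infinity>\<close> as well.\<close>

primrec stop :: "(real \<Rightarrow> real) \<Rightarrow> real \<Rightarrow> real \<Rightarrow> real \<Rightarrow> nat \<Rightarrow> ereal \<times> stop_kind" where
  "stop g l a b 0 = (tau0 g l a, kind0 g l a b)"
| "stop g l a b (Suc j) =
     (let T = fst (stop g l a b j) in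
      case snd (stop g l a b j) of
        Upstop \<Rightarrow>
          (min_time {t. ereal t > T \<and> (SUP s \<in> {s. T \<le> ereal s \<and> s \<le> t}. g s) - g t \<ge> l}, Downstop)
      | Downstop \<Rightarrow>
          (min_time {t. ereal t > T \<and> g t - (INF s \<in> {s. T \<le> ereal s \<and> s \<le> t}. g s) \<ge> l}, Upstop)
      | Nostop \<Rightarrow> (\<infinity>, Nostop))"

definition tau :: "(real \<Rightarrow> real) \<Rightarrow> real \<Rightarrow> real \<Rightarrow> real \<Rightarrow> nat \<Rightarrow> ereal" where
  "tau g l a b j = fst (stop g l a b j)"

definition kind :: "(real \<Rightarrow> real) \<Rightarrow> real \<Rightarrow> real \<Rightarrow> real \<Rightarrow> nat \<Rightarrow> stop_kind" where
  "kind g l a b j = snd (stop g l a b j)"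

text \<open>For \<open>j \<ge> 1\<close> the value \<open>m\<^sub>j\<close> is meaningful only if \<open>\<tau>\<^bsub>j-1\<^esub> < b\<close>; this also excludes the last
  case.\<close>

definition mval :: "(real \<Rightarrow> real) \<Rightarrow> real \<Rightarrow> real \<Rightarrow> real \<Rightarrow> nat \<Rightarrow> real" where
  "mval g l a b j =
     (if j = 0 then g a
      else
        let J = {s. tau g l a b (j - 1) \<le> ereal s \<and> ereal s \<le> min (tau g l a b j) (ereal b)} in
        case kind g l a b j of
          Downstop \<Rightarrow> (SUP s \<in> J. g s)
        | Upstop \<Rightarrow> (INF s \<in> J. g s)
        | Nostop \<Rightarrow> undefined)"

end

theory Submission
  imports Defs
begin

text \<open>Deleting points of an optimal partition shows that its ticks alternate, that all of them have
  size at least \<open>\<lambda>/2\<close> (once \<open>k \<ge> 1\<close>) and that all but the first and the last have size at least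
  \<open>\<lambda>\<close>. Moving a point shows that every interior \<open>t\<^sub>i\<close> is extremal for \<open>f\<close> on \<open>[t\<^bsub>i-1\<^esub>, t\<^bsub>i+1\<^esub>]\<close>. Maximality
  of \<open>k\<close> makes every insertion a strict loss, so no drop by \<open>\<lambda>\<close> occurs strictly inside an uptick.
  Inductively \<open>t\<^sub>j \<le> \<tau>\<^sub>j \<le> t\<^bsub>j+1\<^esub>\<close> as long as \<open>\<tau>\<^sub>j < b\<close>: if \<open>t\<^bsub>j+1\<^esub> > \<tau>\<^bsub>j+1\<^esub>\<close>, the extremum before
  \<open>\<tau>\<^bsub>j+1\<^esub>\<close> and \<open>\<tau>\<^bsub>j+1\<^esub>\<close> itself could be inserted; if \<open>t\<^bsub>j+2\<^esub> < \<tau>\<^bsub>j+1\<^esub>\<close>, the tick ending in \<open>t\<^bsub>j+2\<^esub>\<close>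
  would have triggered the stop earlier.\<close>

section \<open>Variation along lists of points\<close>

text \<open>The sum in \<open>Phi_part\<close> in recursive form: it splits at any listed point, and
  simplification evaluates it on short explicit lists.\<close>

fun variation :: "('a \<Rightarrow> real) \<Rightarrow> 'a list \<Rightarrow> real" where
  "variation f (x # y # zs) = \<bar>f y - f x\<bar> + variation f (y # zs)"
| "variation f _ = 0"

lemma variation_append:
  "variation f (xs @ x # ys) = variation f (xs @ [x]) + variation f (x # ys)"
proof (induction xs)
  case (Cons z zs)
  then show ?case by (cases zs) auto
qed simp

lemma variation_conv_sum:
  "variation f xs = (\<Sum>i<length xs - 1. \<bar>f (xs ! Suc i) - f (xs ! i)\<bar>)"
proof (induction f xs rule: variation.induct)
  case (1 f x y zs)
  then show ?case by (simp add: sum.lessThan_Suc_shift del: sum.lessThan_Suc)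
qed auto

lemma Phi_part_conv_variation:
  assumes "partition_of a b P"
  shows "Phi_part l P f = variation f P - l * real (length P - 2)"
proof -
  have "psize P + 1 = length P - 1"
    using assms unfolding partition_of_def psize_def by linarith
  then show ?thesis
    unfolding Phi_part_def variation_conv_sum
    by (simp only: One_nat_def sum.atLeast1_atMost_eq diff_Suc_Suc diff_zero psize_def)
qed

section \<open>Optimal partitions and exchange of points\<close>

text \<open>Both hypotheses on the partition, attaining the supremum and having the most points
  among maximisers, as comparisons of real numbers without \<open>Phi\<close>.\<close>

definition optimal_partition ::
    "real \<Rightarrow> real \<Rightarrow> real \<Rightarrow> (real \<Rightarrow> real) \<Rightarrow> real list \<Rightarrow> bool" where
  "optimal_partition l a b f P \<longleftrightarrow> partition_of a b P \<and>
     (\<forall>Q. partition_of a b Q \<longrightarrow> Phi_part l Q f \<le> Phi_part l P f \<and>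
        (Phi_part l Q f = Phi_part l P f \<longrightarrow> psize Q \<le> psize P))"

lemma optimal_partition_uminus:
  assumes "optimal_partition l a b f P"
  shows "optimal_partition l a b (\<lambda>t. - f t) P"
proof -
  have "Phi_part l Q (\<lambda>t. - f t) = Phi_part l Q f" for Q
    unfolding Phi_part_def by (simp add: abs_minus_commute)
  then show ?thesis
    using assms by (simp add: optimal_partition_def)
qed

lemma partition_nth_mono:
  assumes "partition_of a b P" "i < j" "j \<le> psize P + 1"
  shows "P ! i < P ! j"
  using assms by (auto simp: partition_of_def psize_def intro: sorted_wrt_nth_less)

lemma partition_nth_0: "partition_of a b P \<Longrightarrow> P ! 0 = a"
  by (cases P) (auto simp: partition_of_def)

lemma partition_nth_last: "partition_of a b P \<Longrightarrow> P ! Suc (psize P) = b"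
  by (cases "P = []") (auto simp: partition_of_def psize_def last_conv_nth Suc_diff_Suc numeral_2_eq_2)

lemma partition_nth_mem:
  assumes "partition_of a b P" "i \<le> psize P + 1"
  shows "P ! i \<in> {a..b}"
  using partition_nth_mono[OF assms(1), of 0 i] partition_nth_mono[OF assms(1), of i "psize P + 1"]
    partition_nth_0[OF assms(1)] partition_nth_last[OF assms(1)] assms(2)
  by (cases "i = 0"; cases "i = psize P + 1") auto

lemma partition_exchange:
  assumes "partition_of a b (xs @ x # M @ y # ys)" "sorted_wrt (<) (x # N @ [y])"
  shows "partition_of a b (xs @ x # N @ y # ys)"
proof -
  have "sorted_wrt (<) (xs @ x # N @ y # ys)"
  proof -
    have P: "sorted_wrt (<) xs" "sorted_wrt (<) ys" "\<forall>v\<in>set ys. y < v"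
      "\<forall>u\<in>set xs. u < x \<and> u < y \<and> (\<forall>v\<in>set ys. u < v)" "\<forall>v\<in>set ys. x < v"
      using assms(1) unfolding partition_of_def by (auto simp: sorted_wrt_append)
    have N: "sorted_wrt (<) N" "x < y" "\<forall>v\<in>set N. x < v \<and> v < y"
      using assms(2) by (auto simp: sorted_wrt_append)
    have "\<forall>u\<in>set xs. \<forall>v\<in>set N. u < v" "\<forall>v\<in>set N. \<forall>w\<in>set ys. v < w"
      using P N by (blast intro: less_trans)+
    with P N show ?thesis by (auto simp: sorted_wrt_append)
  qed
  moreover have "hd (xs @ x # N @ y # ys) = a"
    using assms(1) by (cases xs) (auto simp: partition_of_def)
  moreover have "last (xs @ x # N @ y # ys) = b"
    using assms(1) by (auto simp: partition_of_def)
  ultimately show ?thesis by (simp add: partition_of_def)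
qed

text \<open>Variation is additive at the retained points \<open>x\<close> and \<open>y\<close>, so
  the contributions of \<open>xs\<close> and \<open>ys\<close> cancel. If the exchange adds points,
  a tie would contradict maximality of \<open>psize\<close>, hence the strict form.\<close>

lemma optimal_exchange:
  assumes opt: "optimal_partition l a b f P" and P: "P = xs @ x # M @ y # ys"
    and N: "sorted_wrt (<) (x # N @ [y])"
  shows "variation f (x # N @ [y]) - l * length N \<le> variation f (x # M @ [y]) - l * length M"
    and "length M < length N \<Longrightarrow>
      variation f (x # N @ [y]) - l * length N < variation f (x # M @ [y]) - l * length M"
proof -
  define Q where "Q = xs @ x # N @ y # ys"
  have pP: "partition_of a b P" using opt by (simp add: optimal_partition_def)
  have pQ: "partition_of a b Q"
    using partition_exchange N pP unfolding P Q_def by blast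
  have split: "variation f (xs @ x # K @ y # ys) =
      variation f (xs @ [x]) + variation f (x # K @ [y]) + variation f (y # ys)" for K
    using variation_append[of f xs x "K @ y # ys"] variation_append[of f "x # K" y ys] by simp
  have len: "length P - 2 = length xs + length ys + length M"
      "length Q - 2 = length xs + length ys + length N"
    by (auto simp: P Q_def)
  have diff: "Phi_part l Q f - Phi_part l P f =
      (variation f (x # N @ [y]) - l * length N) - (variation f (x # M @ [y]) - l * length M)"
    unfolding Phi_part_conv_variation[OF pP] Phi_part_conv_variation[OF pQ] len
    unfolding P Q_def split by (simp add: algebra_simps)
  have le: "Phi_part l Q f \<le> Phi_part l P f"
    and eq: "Phi_part l Q f = Phi_part l P f \<Longrightarrow> psize Q \<le> psize P"
    using opt pQ by (auto simp: optimal_partition_def)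
  show "variation f (x # N @ [y]) - l * length N \<le> variation f (x # M @ [y]) - l * length M"
    using le diff by linarith
  show "variation f (x # N @ [y]) - l * length N < variation f (x # M @ [y]) - l * length M"
    if "length M < length N"
  proof -
    have "\<not> psize Q \<le> psize P" using that by (simp add: psize_def len)
    then show ?thesis using le eq diff by fastforce
  qed
qed

text \<open>The explicit \<open>[]\<close> gives the shape that \<open>optimal_exchange\<close>
  expects, with no point removed.\<close>

lemma list_split_2:
  assumes "Suc i < length P"
  shows "P = take i P @ P ! i # [] @ P ! Suc i # drop (Suc (Suc i)) P"
  using assms by (simp add: Cons_nth_drop_Suc)

lemma list_split_3:
  assumes "Suc (Suc i) < length P"
  shows "P = take i P @ P ! i # [P ! Suc i] @ P ! Suc (Suc i) # drop (Suc (Suc (Suc i))) P"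
  using assms by (simp add: Cons_nth_drop_Suc)

lemma list_split_4:
  assumes "Suc (Suc (Suc i)) < length P"
  shows "P = take i P @ P ! i # [P ! Suc i, P ! Suc (Suc i)] @ P ! Suc (Suc (Suc i)) #
    drop (Suc (Suc (Suc (Suc i)))) P"
  using assms by (simp add: Cons_nth_drop_Suc)

lemma optimal_length: "optimal_partition l a b f P \<Longrightarrow> length P = psize P + 2"
  by (auto simp: optimal_partition_def partition_of_def psize_def)

lemma optimal_nth_less:
  "optimal_partition l a b f P \<Longrightarrow> i < j \<Longrightarrow> j \<le> psize P + 1 \<Longrightarrow> P ! i < P ! j"
  using partition_nth_mono by (auto simp: optimal_partition_def)

section \<open>Ticks of an optimal partition\<close>

context
  fixes l a b :: real and f :: "real \<Rightarrow> real" and P :: "real list"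
  assumes opt: "optimal_partition l a b f P" and l_pos: "l > 0"
begin

lemma optimal_insert1:
  assumes "i \<le> psize P" "P ! i < x" "x < P ! Suc i"
  shows "\<bar>f x - f (P ! i)\<bar> + \<bar>f (P ! Suc i) - f x\<bar> < \<bar>f (P ! Suc i) - f (P ! i)\<bar> + l"
  using optimal_exchange(2)[OF opt list_split_2, of i "[x]"] assms optimal_length[OF opt]
  by simp

lemma optimal_insert2:
  assumes "i \<le> psize P" "P ! i < x" "x < y" "y < P ! Suc i"
  shows "\<bar>f x - f (P ! i)\<bar> + \<bar>f y - f x\<bar> + \<bar>f (P ! Suc i) - f y\<bar>
    < \<bar>f (P ! Suc i) - f (P ! i)\<bar> + 2 * l"
  using optimal_exchange(2)[OF opt list_split_2, of i "[x, y]"] assms optimal_length[OF opt]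
  by simp

text \<open>Only a weak inequality, unlike for insertions: a tie with a smaller partition is
  compatible with maximality of \<open>psize\<close>.\<close>

lemma optimal_delete1:
  assumes "Suc i \<le> psize P"
  shows "\<bar>f (P ! Suc (Suc i)) - f (P ! i)\<bar> + l
    \<le> \<bar>f (P ! Suc i) - f (P ! i)\<bar> + \<bar>f (P ! Suc (Suc i)) - f (P ! Suc i)\<bar>"
  using optimal_exchange(1)[OF opt list_split_3, of i "[]"] assms optimal_length[OF opt]
    optimal_nth_less[OF opt, of i "Suc (Suc i)"]
  by simp

lemma optimal_delete2:
  assumes "Suc (Suc i) \<le> psize P"
  shows "\<bar>f (P ! Suc (Suc (Suc i))) - f (P ! i)\<bar> + 2 * l
    \<le> \<bar>f (P ! Suc i) - f (P ! i)\<bar> + \<bar>f (P ! Suc (Suc i)) - f (P ! Suc i)\<bar>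
      + \<bar>f (P ! Suc (Suc (Suc i))) - f (P ! Suc (Suc i))\<bar>"
  using optimal_exchange(1)[OF opt list_split_4, of i "[]"] assms optimal_length[OF opt]
    optimal_nth_less[OF opt, of i "Suc (Suc (Suc i))"]
  by simp

lemma optimal_move:
  assumes "Suc i \<le> psize P" "P ! i < x" "x < P ! Suc (Suc i)"
  shows "\<bar>f x - f (P ! i)\<bar> + \<bar>f (P ! Suc (Suc i)) - f x\<bar>
    \<le> \<bar>f (P ! Suc i) - f (P ! i)\<bar> + \<bar>f (P ! Suc (Suc i)) - f (P ! Suc i)\<bar>"
  using optimal_exchange(1)[OF opt list_split_3, of i "[x]"] assms optimal_length[OF opt]
  by simp

text \<open>Delete an interior endpoint of the tick. If \<open>A\<close> and \<open>B\<close> are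
  the increments on its two sides, then
  \<open>\<bar>A + B\<bar> + l \<le> \<bar>A\<bar> + \<bar>B\<bar>\<close>, and the triangle
  inequality gives \<open>l \<le> 2 * \<bar>A\<bar>\<close> and
  \<open>l \<le> 2 * \<bar>B\<bar>\<close>.\<close>

lemma optimal_tick_ge:
  assumes "1 \<le> psize P" "i \<le> psize P"
  shows "l / 2 \<le> \<bar>f (P ! Suc i) - f (P ! i)\<bar>"
proof (cases "i < psize P")
  case True
  then show ?thesis using optimal_delete1[of i] by linarith
next
  case False
  with assms obtain i' where i': "i = Suc i'" by (cases i) auto
  show ?thesis
    unfolding i' using optimal_delete1[OF assms(2)[unfolded i']] by linarith
qed

text \<open>Between two ticks that do not change direction, deleting the common point costs no
  variation and saves \<open>l\<close>.\<close>

lemma optimal_alternate: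
  assumes "Suc i \<le> psize P" "f (P ! i) < f (P ! Suc i)"
  shows "f (P ! Suc (Suc i)) < f (P ! Suc i)"
  using optimal_delete1[OF assms(1)] assms(2) l_pos by linarith

text \<open>Both neighbours of this downtick are upticks. Deleting its two endpoints loses at most
  twice its size and saves \<open>2 * l\<close>.\<close>

lemma optimal_inner_tick_ge:
  assumes "Suc (Suc i) \<le> psize P" "f (P ! i) < f (P ! Suc i)"
  shows "f (P ! Suc (Suc i)) + l \<le> f (P ! Suc i)"
  using optimal_delete2[OF assms(1)] optimal_alternate[of i] optimal_delete1[of "Suc i"]
    assms l_pos by linarith

text \<open>Moving the middle point to a higher value lengthens both adjacent ticks at the same
  cost; at the two neighbouring points the bound is alternation.\<close>

lemma optimal_peak:
  assumes "Suc i \<le> psize P" "f (P ! i) < f (P ! Suc i)" "P ! i \<le> x" "x \<le> P ! Suc (Suc i)"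
  shows "f x \<le> f (P ! Suc i)"
proof (cases "x = P ! i \<or> x = P ! Suc (Suc i)")
  case True
  then show ?thesis using assms optimal_alternate[of i] by auto
next
  case False
  then show ?thesis using optimal_move[of i x] assms optimal_alternate[of i] by auto
qed

end

section \<open>First times and drops below a running maximum\<close>

lemma min_time_cases:
  assumes "\<forall>t\<in>S. \<exists>m\<in>S. \<forall>u\<in>S. m \<le> u"
  obtains (infinite) "S = {}" "min_time S = \<infinity>"
    | (least) m where "min_time S = ereal m" "m \<in> S" "\<And>u. u \<in> S \<Longrightarrow> m \<le> u"
proof (cases "S = {}")
  case True
  then show ?thesis using infinite by (simp add: min_time_def)
next
  case False
  then obtain m where m: "m \<in> S" "\<forall>u\<in>S. m \<le> u" using assms by blast
  then have "(LEAST t. t \<in> S) = m" by (auto intro: Least_equality)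
  then show ?thesis using least[of m] m False by (simp add: min_time_def)
qed

text \<open>A set of times may be unbounded above, so compactness is asked only of its part up to
  one of its elements.\<close>

lemma compact_attains_least:
  fixes S :: "real set"
  assumes "t \<in> S" "compact (S \<inter> {..t})"
  shows "\<exists>m\<in>S. \<forall>u\<in>S. m \<le> u"
proof -
  obtain m where "m \<in> S \<inter> {..t}" "\<forall>u\<in>S \<inter> {..t}. m \<le> u"
    using compact_attains_inf[OF assms(2)] assms(1) by blast
  then show ?thesis by (metis IntI Int_iff atMost_iff linear order_trans)
qed

lemma SUP_attained:
  fixes h :: "real \<Rightarrow> real"
  assumes "T \<le> t" "continuous_on {T..t} h"
  obtains s where "s \<in> {T..t}" "h s = (SUP s\<in>{T..t}. h s)" "\<And>u. u \<in> {T..t} \<Longrightarrow> h u \<le> h s"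
proof -
  obtain s where s: "s \<in> {T..t}" "\<forall>u\<in>{T..t}. h u \<le> h s"
    using continuous_attains_sup[of "{T..t}" h] assms by auto
  then have "(SUP s\<in>{T..t}. h s) = h s" by (intro cSup_eq_maximum) auto
  with s show ?thesis by (intro that[of s]) auto
qed

text \<open>The downstop that follows an upstop at \<open>T\<close>, as a function of
  \<open>T\<close> alone.\<close>

definition drop_time :: "(real \<Rightarrow> real) \<Rightarrow> real \<Rightarrow> real \<Rightarrow> ereal" where
  "drop_time h l T = min_time {t. t > T \<and> (SUP s\<in>{T..t}. h s) - h t \<ge> l}"

text \<open>The maximum is attained, so the supremum can be traded for a witness \<open>s\<close>.
  The condition \<open>t > T\<close> is then automatic, since \<open>s = t\<close> would give a drop
  of \<open>0 < l\<close>.\<close>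

lemma drop_set_eq:
  fixes h :: "real \<Rightarrow> real"
  assumes "l > 0" "continuous_on {T..} h"
  shows "{t. t > T \<and> (SUP s\<in>{T..t}. h s) - h t \<ge> l} = {t. \<exists>s. T \<le> s \<and> s \<le> t \<and> h s - h t \<ge> l}"
proof -
  have "t > T \<and> (SUP s\<in>{T..t}. h s) - h t \<ge> l \<longleftrightarrow> (\<exists>s. T \<le> s \<and> s \<le> t \<and> h s - h t \<ge> l)" for t
  proof (cases "T \<le> t")
    case True
    have cont: "continuous_on {T..t} h"
      using assms(2) by (rule continuous_on_subset) auto
    obtain s where
      s: "s \<in> {T..t}" "h s = (SUP s\<in>{T..t}. h s)" "\<And>u. u \<in> {T..t} \<Longrightarrow> h u \<le> h s"
      using SUP_attained[OF True cont] by blast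
    show ?thesis
    proof
      assume "t > T \<and> (SUP s\<in>{T..t}. h s) - h t \<ge> l"
      then show "\<exists>s. T \<le> s \<and> s \<le> t \<and> h s - h t \<ge> l"
        using s(1,2) by auto
    next
      assume "\<exists>s. T \<le> s \<and> s \<le> t \<and> h s - h t \<ge> l"
      then obtain u where u: "T \<le> u" "u \<le> t" "h u - h t \<ge> l" by blast
      then have "h u \<le> h s" using s(3) by simp
      moreover have "u \<noteq> t" using u assms(1) by auto
      ultimately show "t > T \<and> (SUP s\<in>{T..t}. h s) - h t \<ge> l"
        using u s(2) by auto
    qed
  qed auto
  then show ?thesis by blast
qed

text \<open>Pairs \<open>(s, t)\<close> with a drop of at least \<open>l\<close> form a closed set.
  Its compact truncation projects to a compact set of times, so a nonempty set of drop times has a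
  first element.\<close>

lemma drop_time_cases:
  fixes h :: "real \<Rightarrow> real"
  assumes l: "l > 0" and cont: "continuous_on {T..} h"
  obtains (infinite) "drop_time h l T = \<infinity>" "\<And>s t. T \<le> s \<Longrightarrow> s \<le> t \<Longrightarrow> h s - h t < l"
    | (drop) d s where "drop_time h l T = ereal d" "T \<le> s" "s < d"
        "h s - h d \<ge> l" "\<And>s t. T \<le> s \<Longrightarrow> s \<le> t \<Longrightarrow> t < d \<Longrightarrow> h s - h t < l"
proof -
  let ?S = "{t. \<exists>s. T \<le> s \<and> s \<le> t \<and> h s - h t \<ge> l}"
  have least: "\<forall>t\<in>?S. \<exists>m\<in>?S. \<forall>u\<in>?S. m \<le> u"
  proof
    fix t assume t: "t \<in> ?S"
    show "\<exists>m\<in>?S. \<forall>u\<in>?S. m \<le> u"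
    proof (rule compact_attains_least[OF t])
      let ?B = "{T..t} \<times> {T..t}"
      let ?K = "?B \<inter> ({p. fst p \<le> snd p} \<inter> {p \<in> ?B. l \<le> h (fst p) - h (snd p)})"
      have cont': "continuous_on {T..t} h"
        using cont by (rule continuous_on_subset) auto
      have "continuous_on ?B (\<lambda>p. h (fst p))" "continuous_on ?B (\<lambda>p. h (snd p))"
        by (rule continuous_on_compose2[OF cont']; force intro: continuous_on_fst continuous_on_snd)+
      then have "closed {p \<in> ?B. l \<le> h (fst p) - h (snd p)}"
        by (intro continuous_on_closed_Collect_le continuous_on_const continuous_on_diff closed_Times
            closed_atLeastAtMost)
      moreover have "closed {p :: real \<times> real. fst p \<le> snd p}"
        by (intro closed_Collect_le continuous_on_fst continuous_on_snd continuous_on_id)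
      ultimately have "compact ?K"
        by (intro compact_Int_closed closed_Int compact_Times compact_Icc)
      then have "compact (snd ` ?K)"
        by (intro compact_continuous_image continuous_on_snd continuous_on_id)
      also have "snd ` ?K = ?S \<inter> {..t}"
      proof (intro equalityI subsetI)
        fix u assume "u \<in> ?S \<inter> {..t}"
        then obtain s where "T \<le> s" "s \<le> u" "h s - h u \<ge> l" "u \<le> t" by blast
        then have "(s, u) \<in> ?K" by auto
        then show "u \<in> snd ` ?K" by force
      qed auto
      finally show "compact (?S \<inter> {..t})" .
    qed
  qed
  have eq: "drop_time h l T = min_time ?S"
    unfolding drop_time_def drop_set_eq[OF assms] ..
  show ?thesis
  proof (rule min_time_cases[of ?S, OF least])
    show thesis if "?S = {}" "min_time ?S = \<infinity>"
    proof (rule infinite)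
      show "drop_time h l T = \<infinity>" unfolding eq by (rule that(2))
      show "h s - h t < l" if "T \<le> s" "s \<le> t" for s t
      proof (rule ccontr)
        assume "\<not> h s - h t < l"
        with that have "t \<in> ?S" by auto
        with \<open>?S = {}\<close> show False by (simp only: empty_iff)
      qed
    qed
    show thesis if m: "min_time ?S = ereal m" "m \<in> ?S" "\<And>u. u \<in> ?S \<Longrightarrow> m \<le> u" for m
    proof -
      obtain s where s: "T \<le> s" "s \<le> m" "h s - h m \<ge> l" using m(2) by blast
      moreover have "s \<noteq> m" using s l by auto
      moreover have "h s - h t < l" if "T \<le> s" "s \<le> t" "t < m" for s t
        using m(3)[of t] that by fastforce
      ultimately show thesis using drop[of m s] eq m(1) by fastforce
    qed
  qed
qed

section \<open>The inductive step after an upstop\<close>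

text \<open>Here \<open>T\<close> stands for the upstop \<tau> with index \<open>i\<close>. If the
  next drop comes before \<open>b\<close>, it is trapped between the next two points of
  \<open>P\<close>. If not, no inner downtick fits after \<open>P ! Suc i\<close>, so at most one
  more interior point exists, and the size of the final descent decides whether it does.\<close>

lemma optimal_step:
  fixes h :: "real \<Rightarrow> real"
  assumes opt: "optimal_partition l a b h P" and l: "l > 0" and cont: "continuous_on {a..} h"
    and i: "i \<le> psize P" and T: "P ! i \<le> T" "T \<le> P ! Suc i" "T < b"
    and rise: "h (P ! i) + l / 2 \<le> h T" and up: "h (P ! i) < h (P ! Suc i)"
  shows "drop_time h l T = ereal d \<Longrightarrow> d < b \<Longrightarrow>
      Suc i \<le> psize P \<and> P ! Suc i \<le> d \<and> d \<le> P ! Suc (Suc i) \<and>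
      h (P ! Suc i) = (SUP s\<in>{T..d}. h s) \<and> h d + l \<le> h (P ! Suc i) \<and>
      h (P ! Suc (Suc i)) < h (P ! Suc i)" (is "_ \<Longrightarrow> _ \<Longrightarrow> ?concl1")
    and "ereal b \<le> drop_time h l T \<Longrightarrow>
      (psize P = i \<and> \<bar>(SUP s\<in>{T..b}. h s) - h b\<bar> < l / 2) \<or>
      (psize P = Suc i \<and> P ! Suc i < b \<and> h (P ! Suc i) = (SUP s\<in>{T..b}. h s) \<and>
       \<bar>(SUP s\<in>{T..b}. h s) - h b\<bar> \<ge> l / 2)" (is "_ \<Longrightarrow> ?concl2")
proof -
  have part: "partition_of a b P" using opt by (simp add: optimal_partition_def)
  have last: "P ! Suc (psize P) = b" using part by (rule partition_nth_last)
  have less_b: "P ! j < b" if "j \<le> psize P" for j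
    using partition_nth_mono[OF part, of j "psize P + 1"] that last by simp
  have aT: "a \<le> T" using partition_nth_mem[OF part, of i] i T by auto
  have contT: "continuous_on {T..} h" using cont by (rule continuous_on_subset) (use aT in auto)
  have cont': "continuous_on {T..t} h" for t using contT by (rule continuous_on_subset) auto
  \<comment> \<open>Ensures that the maximiser \<open>s\<close> chosen below lies strictly to the
    right of \<open>P ! i\<close>, so that it may be inserted.\<close>
  have notT: "P ! i < s" if "T \<le> s" "h T \<le> h s" for s
    using that T rise l by (cases "s = P ! i") auto
  show ?concl1 if d: "drop_time h l T = ereal d" "d < b"
  proof -
    obtain r where r: "T \<le> r" "r < d" "h r - h d \<ge> l"
      and before: "\<And>s t. T \<le> s \<Longrightarrow> s \<le> t \<Longrightarrow> t < d \<Longrightarrow> h s - h t < l"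
      using d(1) by (cases rule: drop_time_cases[OF l contT]) auto
    obtain s where s: "s \<in> {T..d}" "h s = (SUP s\<in>{T..d}. h s)" "\<And>u. u \<in> {T..d} \<Longrightarrow> h u \<le> h s"
      using SUP_attained[of T d h] r cont' by auto
    have drop: "h s - h d \<ge> l" using s(3)[of r] r by auto
    then have "s \<noteq> d" using l by auto
    then have sd: "s < d" using s(1) by auto
    have Pis: "P ! i < s" using notT s(1) s(3)[of T] r by auto
    have le_d: "P ! Suc i \<le> d"
    proof (rule ccontr)
      assume "\<not> P ! Suc i \<le> d"
      \<comment> \<open>Inserting \<open>s\<close> and \<open>d\<close> into the uptick adds at
        least twice the drop \<open>h s - h d\<close>, hence at least \<open>2 * l\<close>, whereas
        an insertion must be a strict loss.\<close>
      then show False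
        using optimal_insert2[OF opt l i Pis sd] up drop by linarith
    qed
    then have i': "Suc i \<le> psize P" using i last d(2) by (cases "i = psize P") auto
    have ge_d: "d \<le> P ! Suc (Suc i)"
    proof (rule ccontr)
      assume *: "\<not> d \<le> P ! Suc (Suc i)"
      then have "Suc (Suc i) \<le> psize P" using i' last d(2) by (cases "Suc i = psize P") auto
      \<comment> \<open>The downtick after \<open>P ! Suc i\<close> would be inner, so a drop by
        \<open>l\<close> would be complete before \<open>d\<close>.\<close>
      from optimal_inner_tick_ge[OF opt l this up] show False
        using before[of "P ! Suc i" "P ! Suc (Suc i)"] T * optimal_nth_less[OF opt, of "Suc i" "Suc (Suc i)"] i'
        by auto
    qed
    have "h s \<le> h (P ! Suc i)"
      using optimal_peak[OF opt l i' up, of s] Pis sd ge_d by auto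
    moreover have "h (P ! Suc i) \<le> h s" using s(3) T le_d by auto
    ultimately show ?thesis
      using i' le_d ge_d s(2) drop optimal_alternate[OF opt l i' up] by auto
  qed
  show ?concl2 if d: "ereal b \<le> drop_time h l T"
  proof -
    have before: "h s - h t < l" if "T \<le> s" "s \<le> t" "t < b" for s t
      using d that by (cases rule: drop_time_cases[OF l contT]) auto
    obtain s where s: "s \<in> {T..b}" "h s = (SUP s\<in>{T..b}. h s)" "\<And>u. u \<in> {T..b} \<Longrightarrow> h u \<le> h s"
      using SUP_attained[of T b h] T(3) cont' by auto
    have sb: "h b \<le> h s" using s(3) T(3) by simp
    have Pis: "P ! i < s" using notT s(1) s(3)[of T] T(3) by auto
    have "\<not> Suc (Suc i) \<le> psize P"
    proof
      assume *: "Suc (Suc i) \<le> psize P"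
      from optimal_inner_tick_ge[OF opt l this up] show False
        using before[of "P ! Suc i" "P ! Suc (Suc i)"] T less_b[OF *]
          optimal_nth_less[OF opt, of "Suc i" "Suc (Suc i)"] * by auto
    qed
    then consider "psize P = i" | "psize P = Suc i" using i by linarith
    then show ?thesis
    proof cases
      case 1
      then have b: "P ! Suc i = b" using last by simp
      have "h s - h b < l / 2"
      proof (cases "s = b")
        case False
        then have "s < b" using s(1) by auto
        then show ?thesis
          \<comment> \<open>Inserting \<open>s\<close> into the last uptick would add at least
            \<open>2 * (h s - h b)\<close> to the variation, which must stay below the cost
            \<open>l\<close>.\<close>
          using optimal_insert1[OF opt l i Pis] up b by auto
      qed (use l in simp)
      then show ?thesis using 1 s(2) sb by auto
    next
      case 2
      then have i': "Suc i \<le> psize P" and b: "P ! Suc (Suc i) = b" using last by auto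
      have "h s \<le> h (P ! Suc i)"
        using optimal_peak[OF opt l i' up, of s] Pis s(1) b by auto
      moreover have "h (P ! Suc i) \<le> h s" using s(3) T less_b[OF i'] by auto
      moreover have "l / 2 \<le> \<bar>h b - h (P ! Suc i)\<bar>"
        using optimal_tick_ge[OF opt l, of "Suc i"] i' b by simp
      ultimately show ?thesis using 2 s(2) less_b[OF i'] sb by auto
    qed
  qed
qed

section \<open>Reduction to upstops by a change of sign\<close>

text \<open>Multiplying \<open>g\<close> by the direction of \<open>\<tau>\<^sub>j\<close> turns the next extremum \<open>m\<^bsub>j+1\<^esub>\<close> into a maximum and
  the next stopping time into a drop time, so only upstops have to be analysed.\<close>

definition direction :: "stop_kind \<Rightarrow> real" where
  "direction K = (if K = Upstop then 1 else - 1)"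

lemma direction_cases: "direction K = 1 \<or> direction K = - 1"
  by (simp add: direction_def)

lemma optimal_partition_direction:
  assumes "optimal_partition l a b g P"
  shows "optimal_partition l a b (\<lambda>t. direction K * g t) P"
  using direction_cases[of K] assms optimal_partition_uminus[OF assms] by auto

lemma INF_eq_uminus_SUP_uminus: "(INF s\<in>A. g s) = - (SUP s\<in>A. - g s)" for g :: "'a \<Rightarrow> real"
  by (simp add: Inf_real_def image_image)

text \<open>After a downstop, the rise of \<open>g\<close> above its running minimum is the drop of
  \<open>- g\<close> below its running maximum, so both branches of \<open>stop\<close> become
  \<open>drop_time\<close>.\<close>

lemma stop_Suc:
  assumes "tau g l a b j = ereal T" "kind g l a b j \<noteq> Nostop"
  shows "tau g l a b (Suc j) = drop_time (\<lambda>t. direction (kind g l a b j) * g t) l T"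
    and "kind g l a b (Suc j) = (if kind g l a b j = Upstop then Downstop else Upstop)"
proof -
  have "{s. ereal T \<le> ereal s \<and> s \<le> t} = {T..t}" for t by auto
  then show "tau g l a b (Suc j) = drop_time (\<lambda>t. direction (kind g l a b j) * g t) l T"
    and "kind g l a b (Suc j) = (if kind g l a b j = Upstop then Downstop else Upstop)"
    using assms unfolding tau_def kind_def drop_time_def
    by (cases "snd (stop g l a b j)";
        simp add: direction_def INF_eq_uminus_SUP_uminus algebra_simps)+
qed

lemma mval_Suc:
  assumes "tau g l a b j = ereal T" "kind g l a b j \<noteq> Nostop"
    and "min (tau g l a b (Suc j)) (ereal b) = ereal c"
  shows "direction (kind g l a b j) * mval g l a b (Suc j) =
    (SUP s\<in>{T..c}. direction (kind g l a b j) * g s)"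
proof -
  have "{s. ereal T \<le> ereal s \<and> ereal s \<le> ereal c} = {T..c}" by auto
  then show ?thesis
    using assms stop_Suc(2)[OF assms(1,2)]
    by (cases "kind g l a b j")
      (simp_all add: mval_def direction_def INF_eq_uminus_SUP_uminus)
qed

text \<open>A drop time lies strictly after its start, and no time follows \<infinity>. Used in
  contrapositive form: a stop before \<open>b\<close> has its predecessor before
  \<open>b\<close>.\<close>

lemma tau_ge_Suc:
  assumes "l > 0" "continuous_on {a..} g" "a < b" "ereal b \<le> tau g l a b j"
  shows "ereal b \<le> tau g l a b (Suc j)"
proof (cases "tau g l a b j")
  case (real T)
  show ?thesis
  proof (cases "kind g l a b j = Nostop")
    case True
    then show ?thesis by (simp add: tau_def kind_def)
  next
    case False
    have "continuous_on {T..} (\<lambda>t. direction (kind g l a b j) * g t)"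
      by (intro continuous_intros continuous_on_subset[OF assms(2)]) (use assms real in auto)
    then show ?thesis
      unfolding stop_Suc(1)[OF real False]
      by (cases rule: drop_time_cases[OF assms(1)]) (use assms real in auto)
  qed
next
  case PInf
  then show ?thesis
    by (cases "kind g l a b j") (simp_all add: tau_def kind_def min_time_def)
qed (use assms in auto)

section \<open>The first exit time\<close>

text \<open>As \<open>h a < c\<close>, allowing \<open>t = a\<close> adds nothing to the set, so its
  truncations are closed despite the strict bound.\<close>

lemma level_set_has_least:
  fixes h :: "real \<Rightarrow> real"
  assumes "continuous_on {a..} h" "h a < c" "t > a" "h t \<ge> c"
  shows "\<exists>m\<in>{t. t > a \<and> h t \<ge> c}. \<forall>u\<in>{t. t > a \<and> h t \<ge> c}. m \<le> u"
proof (rule compact_attains_least)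
  have "{t. t > a \<and> h t \<ge> c} \<inter> {..t} = {a..t} \<inter> {s \<in> {a..t}. c \<le> h s}"
    using assms(2) by (force simp: less_le)
  moreover have "closed {s \<in> {a..t}. c \<le> h s}"
    by (intro continuous_on_closed_Collect_le continuous_on_const closed_atLeastAtMost
        continuous_on_subset[OF assms(1)]) auto
  ultimately show "compact ({t. t > a \<and> h t \<ge> c} \<inter> {..t})"
    by (simp add: compact_Int_closed)
qed (use assms in auto)

lemma tau0_cases:
  fixes g :: "real \<Rightarrow> real"
  assumes l: "l > 0" and cont: "continuous_on {a..} g"
  obtains (infinite) "tau0 g l a = \<infinity>" "\<And>t. t > a \<Longrightarrow> \<bar>g t - g a\<bar> < l / 2"
    | (exit) T where "tau0 g l a = ereal T" "T > a" "\<bar>g T - g a\<bar> \<ge> l / 2"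
        "\<And>t. t > a \<Longrightarrow> t < T \<Longrightarrow> \<bar>g t - g a\<bar> < l / 2"
proof -
  let ?U = "{t. t > a \<and> g t \<ge> g a + l / 2}"
  let ?D = "{t. t > a \<and> g t \<le> g a - l / 2}"
  have U: "\<forall>t\<in>?U. \<exists>m\<in>?U. \<forall>u\<in>?U. m \<le> u"
    using level_set_has_least[OF cont, of "g a + l / 2"] l by auto
  have D: "\<forall>t\<in>?D. \<exists>m\<in>?D. \<forall>u\<in>?D. m \<le> u"
  proof -
    have "continuous_on {a..} (\<lambda>t. - g t)" using cont by (rule continuous_on_minus)
    moreover have "?D = {t. t > a \<and> - g t \<ge> l / 2 - g a}" by auto
    ultimately show ?thesis
      using level_set_has_least[of a "\<lambda>t. - g t" "l / 2 - g a"] l by auto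
  qed
  have mem: "t \<in> ?U \<union> ?D \<longleftrightarrow> t > a \<and> \<bar>g t - g a\<bar> \<ge> l / 2" for t
    using l by (auto simp: abs_if split: if_splits)
  have "(tau0 g l a = \<infinity> \<and> ?U \<union> ?D = {}) \<or>
    (\<exists>T. tau0 g l a = ereal T \<and> T \<in> ?U \<union> ?D \<and> (\<forall>u\<in>?U \<union> ?D. T \<le> u))"
  proof (cases rule: min_time_cases[OF U, case_names infinite least])
    case 2: infinite
    show ?thesis
      by (cases rule: min_time_cases[OF D]) (use 2 in \<open>force simp: tau0_def\<close>)+
  next
    case 2: (least m)
    show ?thesis
    proof (cases rule: min_time_cases[OF D, case_names infinite least])
      case 3: infinite
      then show ?thesis using 2 by (force simp: tau0_def)
    next
      case 3: (least m')
      then have "tau0 g l a = ereal (min m m')" using 2 by (simp add: tau0_def)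
      moreover have "\<forall>u\<in>?U \<union> ?D. min m m' \<le> u"
        using 2(3) 3(3) by (meson Un_iff min.coboundedI1 min.coboundedI2)
      moreover have "min m m' \<in> ?U \<union> ?D" using 2(2) 3(2) by (simp add: min_def)
      ultimately show ?thesis by blast
    qed
  qed
  then show ?thesis
  proof (elim disjE exE conjE)
    assume "tau0 g l a = \<infinity>" "?U \<union> ?D = {}"
    then show ?thesis using infinite mem by (metis (no_types, lifting) empty_iff not_le)
  next
    fix T assume "tau0 g l a = ereal T" "T \<in> ?U \<union> ?D" "\<forall>u\<in>?U \<union> ?D. T \<le> u"
    then show ?thesis using exit mem by (metis (no_types, lifting) not_le)
  qed
qed

section \<open>The invariant along the stopping times\<close>

text \<open>The hypotheses of \<open>optimal_step\<close> at \<tau> with index \<open>j\<close>, up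
  to sign. The rise is only \<open>l / 2\<close> because \<tau> with index 0 gives no more; later
  stops give \<open>l\<close>.\<close>

definition stop_invariant ::
    "(real \<Rightarrow> real) \<Rightarrow> real \<Rightarrow> real \<Rightarrow> real \<Rightarrow> real list \<Rightarrow> nat \<Rightarrow> real \<Rightarrow> bool" where
  "stop_invariant g l a b P j T \<longleftrightarrow>
     tau g l a b j = ereal T \<and> kind g l a b j \<noteq> Nostop \<and> T < b \<and>
     j \<le> psize P \<and> P ! j \<le> T \<and> T \<le> P ! Suc j \<and>
     (let d = direction (kind g l a b j) in
        d * g (P ! j) + l / 2 \<le> d * g T \<and> d * g (P ! j) < d * g (P ! Suc j))"

context
  fixes l a b :: real and g :: "real \<Rightarrow> real" and P :: "real list"
  assumes opt: "optimal_partition l a b g P" and l_pos: "l > 0" and ab: "a < b"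
    and cont: "continuous_on {a..} g"
begin

lemma stop_invariant_0:
  assumes "tau g l a b 0 < ereal b"
  shows "\<exists>T. stop_invariant g l a b P 0 T"
proof -
  have part: "partition_of a b P" using opt by (simp add: optimal_partition_def)
  obtain T where T: "tau0 g l a = ereal T" "T > a" "\<bar>g T - g a\<bar> \<ge> l / 2"
      and before: "\<And>t. t > a \<Longrightarrow> t < T \<Longrightarrow> \<bar>g t - g a\<bar> < l / 2"
    using assms by (cases rule: tau0_cases[OF l_pos cont]) (auto simp: tau_def)
  have Tb: "T < b" using assms T by (simp add: tau_def)
  define K where "K = kind g l a b 0"
  have K: "K = (if g T > g a then Upstop else Downstop)"
    using T Tb l_pos by (auto simp: K_def kind_def kind0_def min_def)
  define h where "h = (\<lambda>t. direction K * g t)"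
  have opth: "optimal_partition l a b h P"
    unfolding h_def by (rule optimal_partition_direction[OF opt])
  have rise: "h a + l / 2 \<le> h T" using T(3) by (auto simp: h_def K direction_def)
  have P0: "P ! 0 = a" using part by (rule partition_nth_0)
  have P1: "a < P ! Suc 0" using optimal_nth_less[OF opt, of 0 "Suc 0"] P0 by simp
  have TP: "T \<le> P ! Suc 0"
  proof (rule ccontr)
    assume *: "\<not> T \<le> P ! Suc 0"
    \<comment> \<open>Without interior points \<open>P ! Suc 0\<close> would be
      \<open>b > T\<close>. With one, the first tick has size at least \<open>l / 2\<close>, which
      cannot happen before the exit time \<open>T\<close>.\<close>
    then have "psize P \<noteq> 0"
      using partition_nth_last[OF part] Tb by (cases "psize P") auto
    then show False using optimal_tick_ge[OF opt l_pos, of 0] before[OF P1] * P0 by simp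
  qed
  have "h a < h (P ! Suc 0)"
  proof (rule ccontr)
    assume *: "\<not> h a < h (P ! Suc 0)"
    then have "T \<noteq> P ! Suc 0" using rise l_pos by auto
    then have "T < P ! Suc 0" using TP by simp
    \<comment> \<open>If the first tick did not rise, inserting \<open>T\<close> would add twice the
      rise up to \<open>T\<close>, which is at least \<open>l\<close>.\<close>
    then show False
      using optimal_insert1[OF opth l_pos, of 0 T] T(2) P0 rise * by auto
  qed
  then have "stop_invariant g l a b P 0 T"
    using T Tb TP P0 rise K by (auto simp: stop_invariant_def tau_def Let_def h_def K_def[symmetric])
  then show ?thesis ..
qed

lemma stop_invariant_Suc:
  assumes "stop_invariant g l a b P j T"
  shows "tau g l a b (Suc j) = ereal d \<Longrightarrow> d < b \<Longrightarrow>
      stop_invariant g l a b P (Suc j) d \<and> g (P ! Suc j) = mval g l a b (Suc j)"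
      (is "_ \<Longrightarrow> _ \<Longrightarrow> ?concl1")
    and "ereal b \<le> tau g l a b (Suc j) \<Longrightarrow>
      (psize P = j \<and> \<bar>mval g l a b (Suc j) - g b\<bar> < l / 2) \<or>
      (psize P = Suc j \<and> P ! Suc j < b \<and> g (P ! Suc j) = mval g l a b (Suc j) \<and>
       \<bar>mval g l a b (Suc j) - g b\<bar> \<ge> l / 2)"
      (is "_ \<Longrightarrow> ?concl2")
proof -
  define K where "K = kind g l a b j"
  define h where "h = (\<lambda>t. direction K * g t)"
  have inv: "tau g l a b j = ereal T" "K \<noteq> Nostop" "T < b" "j \<le> psize P" "P ! j \<le> T"
      "T \<le> P ! Suc j" "h (P ! j) + l / 2 \<le> h T" "h (P ! j) < h (P ! Suc j)"
    using assms by (auto simp: stop_invariant_def h_def K_def Let_def)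
  have opth: "optimal_partition l a b h P"
    unfolding h_def by (rule optimal_partition_direction[OF opt])
  have conth: "continuous_on {a..} h"
    unfolding h_def by (intro continuous_intros cont)
  note step = optimal_step[OF opth l_pos conth inv(4,5,6,3,7,8)]
  have kj: "kind g l a b j \<noteq> Nostop" using inv(2) by (simp add: K_def)
  have tau: "tau g l a b (Suc j) = drop_time h l T"
    using stop_Suc(1)[OF inv(1) kj] by (simp add: h_def K_def)
  have kind: "direction (kind g l a b (Suc j)) = - direction K"
      "kind g l a b (Suc j) \<noteq> Nostop"
    using stop_Suc(2)[OF inv(1) kj] by (auto simp: K_def direction_def)
  have m: "direction K * mval g l a b (Suc j) = (SUP s\<in>{T..c}. h s)"
    if "min (tau g l a b (Suc j)) (ereal b) = ereal c" for c
    using mval_Suc[OF inv(1) kj that] by (simp add: h_def K_def)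
  show ?concl1 if d: "tau g l a b (Suc j) = ereal d" "d < b"
  proof -
    have s: "Suc j \<le> psize P \<and> P ! Suc j \<le> d \<and> d \<le> P ! Suc (Suc j) \<and>
      h (P ! Suc j) = (SUP s\<in>{T..d}. h s) \<and> h d + l \<le> h (P ! Suc j) \<and>
      h (P ! Suc (Suc j)) < h (P ! Suc j)"
      using step(1) d tau by auto
    have "direction K * mval g l a b (Suc j) = h (P ! Suc j)"
      using m[of d] d s by auto
    then have "g (P ! Suc j) = mval g l a b (Suc j)"
      using direction_cases[of K] by (auto simp: h_def)
    \<comment> \<open>The direction flips: the drop by \<open>l\<close> and the following downtick
      of \<open>h\<close> become the rise and the uptick that the invariant requires at
      \<open>Suc j\<close>.\<close>
    then show ?thesis
      using s d kind l_pos by (auto simp: stop_invariant_def Let_def h_def)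
  qed
  show ?concl2 if d: "ereal b \<le> tau g l a b (Suc j)"
  proof -
    have mb: "(SUP s\<in>{T..b}. h s) = direction K * mval g l a b (Suc j)"
      using m[of b] d by (simp add: min_absorb2)
    have "\<bar>direction K * mval g l a b (Suc j) - h b\<bar> = \<bar>mval g l a b (Suc j) - g b\<bar>"
      using direction_cases[of K] by (auto simp: h_def)
    moreover have "h (P ! Suc j) = direction K * mval g l a b (Suc j) \<longleftrightarrow>
        g (P ! Suc j) = mval g l a b (Suc j)"
      using direction_cases[of K] by (auto simp: h_def)
    ultimately show ?thesis
      using step(2) d unfolding tau mb by simp
  qed
qed

lemma stop_invariant_exists:
  assumes "tau g l a b j < ereal b"
  shows "\<exists>T. stop_invariant g l a b P j T"
  using assms
proof (induction j)
  case 0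
  then show ?case by (rule stop_invariant_0)
next
  case (Suc j)
  then obtain T where inv: "stop_invariant g l a b P j T"
    using tau_ge_Suc[OF l_pos cont ab, of j] by (meson not_le)
  show ?case
  proof (cases "tau g l a b (Suc j)")
    case (real d)
    then show ?thesis using stop_invariant_Suc(1)[OF inv real] Suc.prems by auto
  next
    \<comment> \<open>The type \<open>ereal\<close> also has the value -\<infinity>, which a drop
      time never takes.\<close>
    case MInf
    obtain T where T: "tau g l a b j = ereal T" "kind g l a b j \<noteq> Nostop" "a \<le> T"
      using inv partition_nth_mem[of a b P j] opt
      by (auto simp: stop_invariant_def optimal_partition_def)
    have "continuous_on {T..} (\<lambda>t. direction (kind g l a b j) * g t)"
      by (intro continuous_intros continuous_on_subset[OF cont]) (use T in auto)
    then show ?thesis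
      using MInf unfolding stop_Suc(1)[OF T(1,2)]
      by (cases rule: drop_time_cases[OF l_pos]) auto
  qed (use Suc.prems in auto)
qed

text \<open>The first tick has size at least \<open>l / 2\<close> and ends before \<open>b\<close>,
  so the exit has happened by then. Later, a stop at or after \<open>b\<close> would leave room for
  too few interior points.\<close>

lemma tau_less_of_le_psize:
  assumes "Suc j \<le> psize P"
  shows "tau g l a b j < ereal b"
  using assms
proof (induction j)
  case 0
  have part: "partition_of a b P" using opt by (simp add: optimal_partition_def)
  have P: "P ! 0 = a" "a < P ! Suc 0" "P ! Suc 0 < b"
    using partition_nth_0[OF part] partition_nth_last[OF part] 0
      optimal_nth_less[OF opt, of 0 "Suc 0"] optimal_nth_less[OF opt, of "Suc 0" "Suc (psize P)"]
    by auto
  have "l / 2 \<le> \<bar>g (P ! Suc 0) - g a\<bar>"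
    using optimal_tick_ge[OF opt l_pos, of 0] 0 P(1) by simp
  then show ?case
    using P by (cases rule: tau0_cases[OF l_pos cont]) (force simp: tau_def)+
next
  case (Suc j)
  then obtain T where inv: "stop_invariant g l a b P j T"
    using stop_invariant_exists[of j] by auto
  then show ?case
    using stop_invariant_Suc(2)[OF inv] Suc.prems by (cases "ereal b \<le> tau g l a b (Suc j)") auto
qed

end

section \<open>Passage from \<open>f\<close> to its extension \<open>g\<close>, and the
  trichotomy\<close>

theorem proposition10:
  fixes l a b :: real and f g :: "real \<Rightarrow> real" and P :: "real list"
  assumes "l > 0" and "a < b"
    and "continuous_on {a..b} f"
    and "continuous_on {a..} g" and "\<And>x. x \<in> {a..b} \<Longrightarrow> g x = f x"
    and "partition_of a b P"
    and "ereal (Phi_part l P f) = Phi a b l f"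
    and "\<And>Q. partition_of a b Q \<Longrightarrow> ereal (Phi_part l Q f) = Phi a b l f \<Longrightarrow> psize Q \<le> psize P"
  shows "(\<forall>j\<ge>1. tau g l a b (j - 1) < ereal b \<longrightarrow>
            (tau g l a b j < ereal b \<longrightarrow>
               psize P \<ge> j
               \<and> tau g l a b (j - 1) \<le> ereal (P ! j) \<and> ereal (P ! j) \<le> tau g l a b j
               \<and> (kind g l a b (j - 1) = Upstop \<longrightarrow> uptick f (P ! (j - 1)) (P ! j))
               \<and> (kind g l a b (j - 1) = Downstop \<longrightarrow> downtick f (P ! (j - 1)) (P ! j)))
          \<and> (tau g l a b j \<ge> ereal b \<and> \<bar>mval g l a b j - f b\<bar> \<ge> l / 2 \<longrightarrow>
               psize P = j \<and> tau g l a b (j - 1) \<le> ereal (P ! j) \<and> P ! j < b)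
          \<and> (tau g l a b j \<ge> ereal b \<and> \<bar>mval g l a b j - f b\<bar> < l / 2 \<longrightarrow>
               psize P = j - 1))
       \<and> (\<forall>j. 1 \<le> j \<and> j \<le> psize P \<longrightarrow>
            tau g l a b (j - 1) < ereal b \<and> f (P ! j) = mval g l a b j)"
proof -
  have part: "partition_of a b P" by fact
  have Phi_fg: "Phi_part l Q f = Phi_part l Q g" if "partition_of a b Q" for Q
  proof -
    have eq: "g (Q ! i) = f (Q ! i)" if "i \<le> psize Q + 1" for i
      using assms(5) partition_nth_mem[OF \<open>partition_of a b Q\<close> that] .
    have "(\<Sum>i=1..psize Q + 1. \<bar>f (Q ! i) - f (Q ! (i - 1))\<bar>) =
        (\<Sum>i=1..psize Q + 1. \<bar>g (Q ! i) - g (Q ! (i - 1))\<bar>)"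
      by (rule sum.cong) (use eq in \<open>force simp del: One_nat_def\<close>)+
    then show ?thesis by (simp only: Phi_part_def)
  qed
  have opt: "optimal_partition l a b g P"
    unfolding optimal_partition_def
  proof (intro conjI allI impI part)
    fix Q assume Q: "partition_of a b Q"
    have "ereal (Phi_part l Q f) \<le> Phi a b l f"
      unfolding Phi_def by (rule SUP_upper) (use Q in simp)
    \<comment> \<open>As \<open>P\<close> attains the supremum, the comparison with
      \<open>Phi\<close> becomes one with \<open>P\<close>, and a tie with \<open>P\<close> makes
      \<open>Q\<close> a maximiser too.\<close>
    then have "ereal (Phi_part l Q f) \<le> ereal (Phi_part l P f)" using assms(7) by simp
    then show "Phi_part l Q g \<le> Phi_part l P g" using Phi_fg Q part by simp
    show "psize Q \<le> psize P" if "Phi_part l Q g = Phi_part l P g"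
      using assms(7) assms(8)[OF Q] that Phi_fg Q part by simp
  qed
  have fg: "g (P ! i) = f (P ! i)" if "i \<le> psize P + 1" for i
    using assms(5) partition_nth_mem[OF part that] .
  have fgb: "g b = f b" using assms(2,5) by simp
  note inv_exists = stop_invariant_exists[OF opt assms(1,2,4)]
  note inv_Suc = stop_invariant_Suc[OF opt assms(1,2,4)]
  \<comment> \<open>The trichotomy with \<open>j = Suc i\<close>, which avoids the truncated
    difference \<open>j - 1\<close>.\<close>
  have tri: "(tau g l a b (Suc i) < ereal b \<longrightarrow>
               psize P \<ge> Suc i
               \<and> tau g l a b i \<le> ereal (P ! Suc i) \<and> ereal (P ! Suc i) \<le> tau g l a b (Suc i)
               \<and> (kind g l a b i = Upstop \<longrightarrow> uptick f (P ! i) (P ! Suc i))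
               \<and> (kind g l a b i = Downstop \<longrightarrow> downtick f (P ! i) (P ! Suc i)))
          \<and> (tau g l a b (Suc i) \<ge> ereal b \<and> \<bar>mval g l a b (Suc i) - f b\<bar> \<ge> l / 2 \<longrightarrow>
               psize P = Suc i \<and> tau g l a b i \<le> ereal (P ! Suc i) \<and> P ! Suc i < b)
          \<and> (tau g l a b (Suc i) \<ge> ereal b \<and> \<bar>mval g l a b (Suc i) - f b\<bar> < l / 2 \<longrightarrow>
               psize P = i)"
    if less: "tau g l a b i < ereal b" for i
  proof -
    obtain T where inv: "stop_invariant g l a b P i T" using inv_exists less by blast
    then have T: "tau g l a b i = ereal T" "T \<le> P ! Suc i" "i \<le> psize P"
      and dir: "direction (kind g l a b i) * g (P ! i) < direction (kind g l a b i) * g (P ! Suc i)"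
      by (auto simp: stop_invariant_def Let_def)
    have "psize P \<ge> Suc i \<and> ereal (P ! Suc i) \<le> tau g l a b (Suc i)"
      if "tau g l a b (Suc i) < ereal b"
      using inv_exists[OF that] by (auto simp: stop_invariant_def)
    moreover have "(kind g l a b i = Upstop \<longrightarrow> uptick f (P ! i) (P ! Suc i))
               \<and> (kind g l a b i = Downstop \<longrightarrow> downtick f (P ! i) (P ! Suc i))"
      using dir T(3) fg[of i] fg[of "Suc i"] by (auto simp: uptick_def downtick_def direction_def)
    \<comment> \<open>The two alternatives for a stop at or after \<open>b\<close> differ in whether
      the final gap reaches \<open>l / 2\<close>, so the assumption of each case selects one of
      them.\<close>
    ultimately show ?thesis
      using inv_Suc(2)[OF inv] T fgb by auto
  qed
  \<comment> \<open>The bound on \<open>tau\<close> is included because it is what makes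
    \<open>mval\<close> meaningful at \<open>Suc i\<close>.\<close>
  have val: "tau g l a b i < ereal b \<and> f (P ! Suc i) = mval g l a b (Suc i)"
    if i: "Suc i \<le> psize P" for i
  proof -
    have less: "tau g l a b i < ereal b"
      by (rule tau_less_of_le_psize[OF opt assms(1,2,4) i])
    obtain T where inv: "stop_invariant g l a b P i T" using inv_exists less by blast
    have "g (P ! Suc i) = mval g l a b (Suc i)"
    proof (cases "tau g l a b (Suc i) < ereal b")
      case True
      then obtain d where "stop_invariant g l a b P (Suc i) d" using inv_exists by blast
      then show ?thesis using inv_Suc(1)[OF inv, of d] by (simp add: stop_invariant_def)
    next
      case False
      then show ?thesis using inv_Suc(2)[OF inv] i by auto
    qed
    then show ?thesis using less fg[of "Suc i"] i by simp
  qed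
  show ?thesis
  proof (intro conjI)
    show "\<forall>j\<ge>1. tau g l a b (j - 1) < ereal b \<longrightarrow>
            (tau g l a b j < ereal b \<longrightarrow>
               psize P \<ge> j
               \<and> tau g l a b (j - 1) \<le> ereal (P ! j) \<and> ereal (P ! j) \<le> tau g l a b j
               \<and> (kind g l a b (j - 1) = Upstop \<longrightarrow> uptick f (P ! (j - 1)) (P ! j))
               \<and> (kind g l a b (j - 1) = Downstop \<longrightarrow> downtick f (P ! (j - 1)) (P ! j)))
          \<and> (tau g l a b j \<ge> ereal b \<and> \<bar>mval g l a b j - f b\<bar> \<ge> l / 2 \<longrightarrow>
               psize P = j \<and> tau g l a b (j - 1) \<le> ereal (P ! j) \<and> P ! j < b)
          \<and> (tau g l a b j \<ge> ereal b \<and> \<bar>mval g l a b j - f b\<bar> < l / 2 \<longrightarrow>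
               psize P = j - 1)"
      using tri by (auto simp: Suc_le_eq gr0_conv_Suc)
    show "\<forall>j. 1 \<le> j \<and> j \<le> psize P \<longrightarrow>
            tau g l a b (j - 1) < ereal b \<and> f (P ! j) = mval g l a b j"
      using val by (auto simp: Suc_le_eq gr0_conv_Suc)
  qed
qed

end
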